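(* Let $\varphi=\frac{\sqrt5-1}{2}$, and for integers $n\ge0$, $d\ge1$ let $F_n(d)$ be the probability that the golden game $G_n(\varphi)$ of depth $n$ is $d$-fragile. Then for every integer $d\ge 1$ the limit $\lim_{n\to\infty}F_n(d)$ exists and $$\lim_{n\to\infty}F_n(d)=1-\varphi\,\xi_d-\varphi^2\xi_d^2,$$ where $\xi_d\in(0,1)$ is the smaller root of the second degree polynomial $\varphi^3H(d)-x+2\varphi^2x^2$ in $x$, and where $H(d)$ is defined recursively by $H(1)=1$ and, for $d>1$, $$H(d)=1-\sum_{r+s=d}(1-\xi_r^2)(1-\xi_s^2)+\sum_{r+s=d-1}(1-\xi_r^2)(1-\xi_s^2),$$ the sums being over ordered pairs $(r,s)$ of integers $r,s\ge1$ with the indicated sum (an empty sum being $0$).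
   Context: For an integer $n\ge 0$, consider the complete binary tree of depth $n$ (with $2^n$ leaves). A node has height $h$ if its distance to the leaves below it is $h$ (leaves have height $0$, the root has height $n$). A game of depth $n$ is an assignment of payoffs in $\{0,1\}$ to the leaves, i.e. an element of $\{0,1\}^{2^n}$. Player 2 acts at the internal nodes of odd height and Player 1 at the internal nodes of even height, each choosing a child; Player 1 wins if the payoff of the reached leaf is $1$, and Player 2 wins if it is $0$. The value of the game in $\{0,1\}$ is given by backward induction: the value of a leaf is its payoff, the value of an internal node of odd height is the minimum of the values of its two children, the value of an internal node of even height is the maximum of the values of its two children, and the value of the game is the value of the root. Player 1 wins the game if its value is $1$, and Player 2 wins if its value is $0$. For $i\in\{1,2\}$ let $W_n^i\subset\{0,1\}^{2^n}$ be the set of games of depth $n$ won by Player $i$, i.e. with value $2-i$. For an integer $d\ge1$, a game $G\in W_n^i$ is $d$-fragile if the Hamming distance of $G$ from the set $W_n^{3-i}$ is at most $d$ (i.e. the value of the game can be changed by flipping at most $d$ leaf payoffs). For $p\in[0,1]$, $G_n(p)\in\{0,1\}^{2^n}$ is the random game whose leaf payoffs are i.i.d. Bernoulli, equal to $1$ with probability $p$ and $0$ with probability $1-p$. The golden game of depth $n$ is $G_n(\varphi)$, and $F_n(d)=\Pr[G_n(\varphi)\text{ is } d\text{-fragile}]$. *)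

theory Defs
  imports "HOL-Probability.Probability" "HOL-Computational_Algebra.Polynomial"
begin

(* Payoff 1 is True and payoff 0 is False; since False < True, min and max on bool
   are the minimum and maximum on {0,1}.  The leaf payoffs are listed from left to right. *)
definition games :: "nat \<Rightarrow> bool list set" where
  "games n = {G. length G = 2 ^ n}"

(* Value of the node of height n whose 2^n leaves carry the payoffs G: the two halves
   of G are the leaves below its left and right child. *)
fun game_value :: "nat \<Rightarrow> bool list \<Rightarrow> bool" where
  "game_value 0 G = G ! 0"
| "game_value (Suc h) G =
     (let l = game_value h (take (2 ^ h) G); r = game_value h (drop (2 ^ h) G)
      in if odd (Suc h) then min l r else max l r)"

(* Only meaningful for i in {1, 2}. *)
definition won_games :: "nat \<Rightarrow> nat \<Rightarrow> bool list set" where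
  "won_games n i = {G \<in> games n. of_bool (game_value n G) = (2 - i :: nat)}"

definition hamming_dist :: "bool list \<Rightarrow> bool list \<Rightarrow> nat" where
  "hamming_dist G G' = card {k. k < length G \<and> G ! k \<noteq> G' ! k}"

(* Taken in enat so that the distance to the empty set is infinite. *)
definition hamming_dist_set :: "bool list \<Rightarrow> bool list set \<Rightarrow> enat" where
  "hamming_dist_set G S = (INF G'\<in>S. enat (hamming_dist G G'))"

definition fragile :: "nat \<Rightarrow> nat \<Rightarrow> bool list \<Rightarrow> bool" where
  "fragile n d G \<longleftrightarrow>
     (\<exists>i\<in>{1, 2}. G \<in> won_games n i \<and> hamming_dist_set G (won_games n (3 - i)) \<le> enat d)"

definition random_game :: "nat \<Rightarrow> real \<Rightarrow> bool list pmf" where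
  "random_game n p = replicate_pmf (2 ^ n) (bernoulli_pmf p)"

definition phi :: real where
  "phi = (sqrt 5 - 1) / 2"

definition fragile_prob :: "nat \<Rightarrow> nat \<Rightarrow> real" where
  "fragile_prob n d = measure_pmf.prob (random_game n phi) {G. fragile n d G}"

definition root_poly :: "real \<Rightarrow> real poly" where
  "root_poly h = [:phi ^ 3 * h, - 1, 2 * phi ^ 2:]"

definition smaller_root :: "real \<Rightarrow> real" where
  "smaller_root h = Min {x. poly (root_poly h) x = 0}"

(* fragility_H and xi are mutually recursive; xi r = smaller_root (fragility_H r) is inlined on the right.
   The value at 0 is irrelevant. *)
function fragility_H :: "nat \<Rightarrow> real" where
  "fragility_H d = (if d \<le> 1 then 1 else
     1 - (\<Sum>(r, s)\<in>{(r, s). 1 \<le> r \<and> 1 \<le> s \<and> r + s = d}.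
            (1 - (smaller_root (fragility_H r))\<^sup>2) * (1 - (smaller_root (fragility_H s))\<^sup>2))
       + (\<Sum>(r, s)\<in>{(r, s). 1 \<le> r \<and> 1 \<le> s \<and> r + s = d - 1}.
            (1 - (smaller_root (fragility_H r))\<^sup>2) * (1 - (smaller_root (fragility_H s))\<^sup>2)))"
  by pat_completeness auto
termination by (relation "Wellfounded.measure id") auto

declare fragility_H.simps [simp del]

definition xi :: "nat \<Rightarrow> real" where
  "xi d = smaller_root (fragility_H d)"

end

theory Submission
  imports Defs
begin

text \<open>Call the player who moves at the root the mover; by the choice of \<^const>\<open>phi\<close> the mover wins the
  golden game with probability \<^const>\<open>phi\<close> at every depth. To beat a winning mover, one has to flip
  every child won by the mover; to rescue a losing mover, the cheaper child suffices. So the distance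
  is a sum or a minimum of the distances at the two independent subgames. Over two levels this turns the
  probability \<open>x\<^sub>d\<close> of a distance above \<open>d\<close>, given that the mover wins, into
  \<open>\<phi>\<^sup>3 h + 2 \<phi>\<^sup>2 x\<^sub>d\<^sup>2\<close>, where \<open>h \<le> 1\<close> depends only on the \<open>x\<^sub>r\<close> with \<open>r < d\<close>
  and tends to \<open>H(d)\<close> by induction. All \<open>x\<^sub>d\<close> with \<open>d \<ge> 1\<close> stay in \<open>[0, \<phi>/2]\<close>, where
  this map is a contraction, hence they tend to its fixed point there, the smaller root.\<close>

section \<open>The distance to the games won by the other player\<close>

text \<open>The least number of flips in \<^term>\<open>G\<close> that make its value \<^term>\<open>b\<close>. The costs add up at the nodes
  where the value \<^term>\<open>b\<close> is needed at both children.\<close>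

fun flip_cost :: "nat \<Rightarrow> bool list \<Rightarrow> bool \<Rightarrow> nat" where
  "flip_cost 0 G b = of_bool (G ! 0 \<noteq> b)"
| "flip_cost (Suc h) G b =
     (let l = flip_cost h (take (2 ^ h) G) b; r = flip_cost h (drop (2 ^ h) G) b
      in if b = odd (Suc h) then l + r else min l r)"

lemma hamming_dist_append:
  assumes "length xs = length xs'" "length ys = length ys'"
  shows "hamming_dist (xs @ ys) (xs' @ ys') = hamming_dist xs xs' + hamming_dist ys ys'"
proof -
  have "hamming_dist G G' = length (filter (\<lambda>(x, y). x \<noteq> y) (zip G G'))"
    if "length G = length G'" for G G'
    using that by (auto simp: hamming_dist_def length_filter_conv_card intro!: arg_cong[where f = card])
  then show ?thesis
    using assms by simp
qed

lemma hamming_dist_eq_0_iff: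
  assumes "length G = length G'"
  shows "hamming_dist G G' = 0 \<longleftrightarrow> G = G'"
  using assms by (auto simp: hamming_dist_def list_eq_iff_nth_eq)

lemma game_value_append:
  assumes "length xs = 2 ^ h"
  shows "game_value (Suc h) (xs @ ys) =
    (if odd (Suc h) then game_value h xs \<and> game_value h ys else game_value h xs \<or> game_value h ys)"
  using assms by (auto simp: Let_def min_def max_def)

lemma flip_cost_append:
  assumes "length xs = 2 ^ h"
  shows "flip_cost (Suc h) (xs @ ys) b =
    (if b = odd (Suc h) then flip_cost h xs b + flip_cost h ys b
     else min (flip_cost h xs b) (flip_cost h ys b))"
  using assms by (simp add: Let_def)

lemma split_game:
  assumes "length G = 2 ^ Suc h"
  obtains xs ys where "G = xs @ ys" "length xs = 2 ^ h" "length ys = 2 ^ h"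
  using assms by (intro that[of "take (2 ^ h) G" "drop (2 ^ h) G"]) auto

text \<open>Lower bound: where the costs add, both halves of \<open>G'\<close> must have the target
  value, and their distances add; elsewhere at least one half has it, and its distance alone
  dominates the minimum.\<close>

lemma flip_cost_le_hamming_dist:
  assumes "length G = 2 ^ n" "length G' = 2 ^ n"
  shows "flip_cost n G (game_value n G') \<le> hamming_dist G G'"
  using assms
proof (induction n arbitrary: G G')
  case 0
  then have "{k. k < length G \<and> G ! k \<noteq> G' ! k} = (if G ! 0 \<noteq> G' ! 0 then {0} else {})"
    by auto
  then show ?case
    by (auto simp: hamming_dist_def)
next
  case (Suc n)
  obtain xs ys where G: "G = xs @ ys" "length xs = 2 ^ n" "length ys = 2 ^ n"
    using Suc.prems(1) by (rule split_game)
  obtain xs' ys' where G': "G' = xs' @ ys'" "length xs' = 2 ^ n" "length ys' = 2 ^ n"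
    using Suc.prems(2) by (rule split_game)
  have "flip_cost n xs (game_value n xs') \<le> hamming_dist xs xs'"
    and "flip_cost n ys (game_value n ys') \<le> hamming_dist ys ys'"
    using Suc.IH G G' by auto
  then show ?case
    unfolding G(1) G'(1) flip_cost_append[OF G(2)] game_value_append[OF G'(2)]
    using G G'
    by (cases "game_value n xs'"; cases "game_value n ys'") (auto simp: hamming_dist_append)
qed

text \<open>Upper bound: optimal targets of both halves are joined where the costs add; otherwise
  only the cheaper half is replaced and the other one is left untouched.\<close>

lemma flip_cost_attained:
  assumes "length G = 2 ^ n"
  shows "\<exists>G'. length G' = 2 ^ n \<and> game_value n G' = b \<and> hamming_dist G G' = flip_cost n G b"
  using assms
proof (induction n arbitrary: G)
  case 0
  then have "{k. k < length G \<and> G ! k \<noteq> [b] ! k} = (if G ! 0 \<noteq> b then {0} else {})"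
    by auto
  then show ?case
    by (intro exI[of _ "[b]"]) (auto simp: hamming_dist_def)
next
  case (Suc n)
  obtain xs ys where G: "G = xs @ ys" "length xs = 2 ^ n" "length ys = 2 ^ n"
    using Suc.prems by (rule split_game)
  obtain xs' where xs': "length xs' = 2 ^ n" "game_value n xs' = b"
      "hamming_dist xs xs' = flip_cost n xs b"
    using Suc.IH G(2) by blast
  obtain ys' where ys': "length ys' = 2 ^ n" "game_value n ys' = b"
      "hamming_dist ys ys' = flip_cost n ys b"
    using Suc.IH G(3) by blast
  have self: "hamming_dist zs zs = 0" for zs
    by (simp add: hamming_dist_eq_0_iff)
  consider "b = odd (Suc n)"
    | "b \<noteq> odd (Suc n)" "flip_cost n xs b \<le> flip_cost n ys b"
    | "b \<noteq> odd (Suc n)" "flip_cost n ys b \<le> flip_cost n xs b"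
    by linarith
  then show ?case
  proof cases
    case 1
    then show ?thesis
      using G xs' ys'
      by (intro exI[of _ "xs' @ ys'"])
        (auto simp: flip_cost_append game_value_append hamming_dist_append
          simp del: flip_cost.simps game_value.simps)
  next
    case 2
    then show ?thesis
      using G xs' self
      by (intro exI[of _ "xs' @ ys"])
        (auto simp: flip_cost_append game_value_append hamming_dist_append
          simp del: flip_cost.simps game_value.simps)
  next
    case 3
    then show ?thesis
      using G ys' self
      by (intro exI[of _ "xs @ ys'"])
        (auto simp: flip_cost_append game_value_append hamming_dist_append
          simp del: flip_cost.simps game_value.simps)
  qed
qed

lemma flip_cost_eq_0_iff:
  assumes "length G = 2 ^ n"
  shows "flip_cost n G b = 0 \<longleftrightarrow> game_value n G = b"
proof
  assume "flip_cost n G b = 0"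
  then show "game_value n G = b"
    using flip_cost_attained[OF assms, of b] assms hamming_dist_eq_0_iff by metis
next
  assume "game_value n G = b"
  then show "flip_cost n G b = 0"
    using flip_cost_le_hamming_dist[OF assms assms] hamming_dist_eq_0_iff[of G G] by simp
qed

lemma hamming_dist_set_le_iff:
  assumes "length G = 2 ^ n"
  shows "hamming_dist_set G {G' \<in> games n. game_value n G' = b} \<le> enat d \<longleftrightarrow> flip_cost n G b \<le> d"
proof -
  have "hamming_dist_set G {G' \<in> games n. game_value n G' = b} = enat (flip_cost n G b)"
    unfolding hamming_dist_set_def
  proof (rule antisym)
    obtain G' where "length G' = 2 ^ n" "game_value n G' = b" "hamming_dist G G' = flip_cost n G b"
      using flip_cost_attained[OF assms] by blast
    then show "(INF G'\<in>{G' \<in> games n. game_value n G' = b}. enat (hamming_dist G G'))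
        \<le> enat (flip_cost n G b)"
      by (intro INF_lower2[of G']) (auto simp: games_def)
    show "enat (flip_cost n G b)
        \<le> (INF G'\<in>{G' \<in> games n. game_value n G' = b}. enat (hamming_dist G G'))"
      using flip_cost_le_hamming_dist[OF assms] by (intro INF_greatest) (auto simp: games_def)
  qed
  then show ?thesis
    by simp
qed

text \<open>The cost of the value that \<open>G\<close> already has is zero, so the conjunction only
  constrains the other cost. This form avoids naming the winner.\<close>

lemma fragile_iff:
  assumes "length G = 2 ^ n"
  shows "fragile n d G \<longleftrightarrow> flip_cost n G True \<le> d \<and> flip_cost n G False \<le> d"
proof -
  have 1: "won_games n 1 = {G \<in> games n. game_value n G = True}"
    and 2: "won_games n 2 = {G \<in> games n. game_value n G = False}"
    by (auto simp: won_games_def of_bool_def split: if_splits)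
  have "fragile n d G \<longleftrightarrow> flip_cost n G (\<not> game_value n G) \<le> d"
    using assms hamming_dist_set_le_iff[OF assms, of True d]
      hamming_dist_set_le_iff[OF assms, of False d]
    unfolding fragile_def by (cases "game_value n G") (auto simp: 1[simplified] 2 games_def)
  then show ?thesis
    using flip_cost_eq_0_iff[OF assms, of "game_value n G"] by (cases "game_value n G") auto
qed

section \<open>The distribution of the distance in the golden game\<close>

lemma phi_pos: "0 < phi" and phi_less_1: "phi < 1" and phi_sq: "phi\<^sup>2 = 1 - phi"
proof -
  have "1 < sqrt 5"
    by (simp add: real_less_rsqrt)
  moreover have "sqrt 5 < 3"
    by (rule real_less_lsqrt) auto
  ultimately show "0 < phi" "phi < 1"
    by (auto simp: phi_def)
  show "phi\<^sup>2 = 1 - phi"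
    by (simp add: phi_def power2_eq_square field_simps)
qed

lemma phi_cube: "phi ^ 3 = 2 * phi - 1"
proof -
  have "phi ^ 3 = phi * phi\<^sup>2"
    by (simp add: power3_eq_cube power2_eq_square)
  also have "\<dots> = phi - phi\<^sup>2"
    unfolding phi_sq[THEN arg_cong, of "\<lambda>x. phi * x"] by (simp add: algebra_simps power2_eq_square)
  finally show ?thesis
    by (simp add: phi_sq)
qed

text \<open>By \<open>phi_cube\<close> this says \<open>phi \<le> 2 / 3\<close>. It gives the
  invariant bound at depth one and the contraction factor \<open>2 * phi ^ 3 < 1\<close>.\<close>

lemma phi_cube_le: "phi ^ 3 \<le> phi / 2"
proof -
  have "phi < 2 / 3"
  proof (rule ccontr)
    assume "\<not> phi < 2 / 3"
    then have "(2 / 3) * (2 / 3) \<le> phi * phi"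
      by (intro mult_mono) auto
    then show False
      using phi_sq \<open>\<not> phi < 2 / 3\<close> by (simp add: power2_eq_square)
  qed
  then show ?thesis
    by (simp add: phi_cube)
qed

section \<open>Tails of the flip cost and their recursion\<close>

lemma random_game_Suc:
  "random_game (Suc n) p =
     map_pmf (\<lambda>(xs, ys). xs @ ys) (pair_pmf (random_game n p) (random_game n p))"
  by (simp add: random_game_def mult_2 replicate_pmf_distrib pair_pmf_def map_bind_pmf)

lemma length_random_game: "G \<in> set_pmf (random_game n p) \<Longrightarrow> length G = 2 ^ n"
  by (auto simp: random_game_def set_replicate_pmf)

definition flip_cost_pmf :: "nat \<Rightarrow> bool \<Rightarrow> nat pmf" where
  "flip_cost_pmf n b = map_pmf (\<lambda>G. flip_cost n G b) (random_game n phi)"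

text \<open>The tail is strict, so at \<open>k = 0\<close> it is the probability that the value is
  not \<open>b\<close>.\<close>

definition tail :: "nat \<Rightarrow> bool \<Rightarrow> nat \<Rightarrow> real" where
  "tail n b k = measure_pmf.prob (flip_cost_pmf n b) {k<..}"

lemma flip_cost_pmf_Suc:
  "flip_cost_pmf (Suc n) b =
     map_pmf (\<lambda>(x, y). if b = odd (Suc n) then x + y else min x y)
       (pair_pmf (flip_cost_pmf n b) (flip_cost_pmf n b))"
proof -
  have "flip_cost_pmf (Suc n) b =
      map_pmf (\<lambda>(xs, ys). flip_cost (Suc n) (xs @ ys) b) (pair_pmf (random_game n phi) (random_game n phi))"
    by (simp add: flip_cost_pmf_def random_game_Suc pmf.map_comp o_def case_prod_unfold
        del: flip_cost.simps)
  also have "\<dots> = map_pmf (\<lambda>(xs, ys). if b = odd (Suc n) then flip_cost n xs b + flip_cost n ys b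
      else min (flip_cost n xs b) (flip_cost n ys b)) (pair_pmf (random_game n phi) (random_game n phi))"
    by (intro map_pmf_cong refl) (auto simp: flip_cost_append length_random_game simp del: flip_cost.simps)
  also have "\<dots> = map_pmf (\<lambda>(x, y). if b = odd (Suc n) then x + y else min x y)
       (pair_pmf (flip_cost_pmf n b) (flip_cost_pmf n b))"
    unfolding flip_cost_pmf_def map_pair[symmetric] pmf.map_comp
    by (intro map_pmf_cong refl) auto
  finally show ?thesis .
qed

lemma tail_nonneg: "0 \<le> tail n b k"
  by (simp add: tail_def)

lemma antimono_tail: "k \<le> l \<Longrightarrow> tail n b l \<le> tail n b k"
  by (auto simp: tail_def intro!: measure_pmf.finite_measure_mono)

lemma prob_atMost_flip_cost: "measure_pmf.prob (flip_cost_pmf n b) {..k} = 1 - tail n b k"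
proof -
  have "{k<..} = UNIV - {..k}"
    by auto
  then show ?thesis
    using measure_pmf.prob_compl[of "{..k}" "flip_cost_pmf n b"] by (simp add: tail_def)
qed

lemma tail_min:
  assumes "b \<noteq> odd (Suc n)"
  shows "tail (Suc n) b k = (tail n b k)\<^sup>2"
proof -
  have "(\<lambda>(x, y). min x y) -` {k<..} = {k<..} \<times> {k<..}"
    by auto
  then show ?thesis
    using assms by (simp add: tail_def flip_cost_pmf_Suc measure_pmf_prob_product power2_eq_square)
qed

text \<open>Conditions on the cost \<open>r\<close> of the left half. Point masses are differences
  of consecutive tails, except at \<open>r = 0\<close>, where \<open>r - 1\<close> truncates; hence
  the separate product.\<close>

lemma tail_sum:
  assumes "b = odd (Suc n)"
  shows "tail (Suc n) b k = 1 - (1 - tail n b 0) * (1 - tail n b k)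
    - (\<Sum>r\<in>{1..k}. (tail n b (r - 1) - tail n b r) * (1 - tail n b (k - r)))"
proof -
  let ?p = "flip_cost_pmf n b"
  have pmf: "pmf ?p r = (if r = 0 then 1 - tail n b 0 else tail n b (r - 1) - tail n b r)" for r
  proof (cases r)
    case 0
    then show ?thesis
      using prob_atMost_flip_cost[of n b 0] by (simp add: measure_pmf_single)
  next
    case (Suc j)
    have "measure_pmf.prob ?p {..Suc j} = measure_pmf.prob ?p {..j} + measure_pmf.prob ?p {Suc j}"
      unfolding atMost_Suc insert_def
      by (subst measure_pmf.finite_measure_Union[symmetric]) (auto intro!: arg_cong[where f = "measure_pmf.prob ?p"])
    then show ?thesis
      using Suc by (simp add: prob_atMost_flip_cost measure_pmf_single)
  qed
  have vim: "(\<lambda>(x, y). x + y) -` {..k} = (\<Union>r\<in>{..k}. {r} \<times> {..k - r})"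
    by auto
  have "1 - tail (Suc n) b k = measure_pmf.prob (pair_pmf ?p ?p) (\<Union>r\<in>{..k}. {r} \<times> {..k - r})"
    unfolding prob_atMost_flip_cost[symmetric] flip_cost_pmf_Suc using assms by (simp add: vim)
  also have "\<dots> = (\<Sum>r\<in>{..k}. measure_pmf.prob (pair_pmf ?p ?p) ({r} \<times> {..k - r}))"
    by (intro measure_pmf.finite_measure_finite_Union) (auto simp: disjoint_family_on_def)
  also have "\<dots> = (\<Sum>r\<in>{..k}. pmf ?p r * (1 - tail n b (k - r)))"
    by (simp add: measure_pmf_prob_product measure_pmf_single prob_atMost_flip_cost)
  also have "{..k} = insert 0 {1..k}"
    by auto
  also have "(\<Sum>r\<in>\<dots>. pmf ?p r * (1 - tail n b (k - r))) = (1 - tail n b 0) * (1 - tail n b k)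
      + (\<Sum>r\<in>{1..k}. (tail n b (r - 1) - tail n b r) * (1 - tail n b (k - r)))"
    by (simp add: pmf)
  finally show ?thesis
    by simp
qed

lemma tail_0: "tail 0 b k = (if k = 0 then if b then 1 - phi else phi else 0)"
proof -
  have "random_game 0 phi = map_pmf (\<lambda>x. [x]) (bernoulli_pmf phi)"
    by (simp add: random_game_def map_pmf_def bind_return_pmf)
  then have "tail 0 b k = measure_pmf.prob (bernoulli_pmf phi) {x. k < of_bool (x \<noteq> b)}"
    by (simp add: tail_def flip_cost_pmf_def pmf.map_comp o_def vimage_def)
  moreover have "{x. k < of_bool (x \<noteq> b)} = (if k = 0 then {\<not> b} else {})"
    by (auto simp: of_bool_def)
  ultimately show ?thesis
    using phi_pos phi_less_1 by (auto simp: measure_pmf_single)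
qed

text \<open>The two events of cost above \<open>d\<close> are disjoint because one of the costs is
  always zero. The tail for \<open>odd n\<close> concerns games won by the mover, the one for
  \<open>even n\<close> games lost by the mover.\<close>

lemma fragile_prob_eq: "fragile_prob n d = 1 - tail n (odd n) d - tail n (even n) d"
proof -
  let ?M = "random_game n phi" and ?B = "\<lambda>b. {G. length G = 2 ^ n \<and> d < flip_cost n G b}"
  have B: "measure_pmf.prob ?M (?B b) = tail n b d" for b
    unfolding tail_def flip_cost_pmf_def measure_map_pmf
    by (intro measure_pmf.finite_measure_eq_AE) (auto simp: AE_measure_pmf_iff length_random_game)
  have "fragile_prob n d = measure_pmf.prob ?M (UNIV - (?B True \<union> ?B False))"
    unfolding fragile_prob_def
    by (intro measure_pmf.finite_measure_eq_AE)
      (auto simp: AE_measure_pmf_iff length_random_game fragile_iff)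
  also have "\<dots> = 1 - measure_pmf.prob ?M (?B True \<union> ?B False)"
    using measure_pmf.prob_compl[of "?B True \<union> ?B False" ?M] by simp
  also have "measure_pmf.prob ?M (?B True \<union> ?B False) = tail n True d + tail n False d"
    unfolding B[symmetric]
  proof (rule measure_pmf.finite_measure_Union)
    have False if "length G = 2 ^ n" "d < flip_cost n G True" "d < flip_cost n G False" for G
      using flip_cost_eq_0_iff[OF that(1), of "game_value n G"] that by (cases "game_value n G") auto
    then show "?B True \<inter> ?B False = {}"
      by blast
  qed auto
  finally show ?thesis
    by (cases "odd n") auto
qed

section \<open>The limit\<close>

text \<open>Once the perturbation is at most \<open>\<epsilon> * (1 - t)\<close>, the excess over
  \<open>\<epsilon>\<close> shrinks by the factor \<open>t\<close> every two steps. The uniform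
  bound \<open>B\<close> serves both parities of \<open>n\<close>.\<close>

lemma tendsto_0_perturbed_contraction:
  fixes e \<delta> :: "nat \<Rightarrow> real"
  assumes nonneg: "\<And>n. 0 \<le> e n" and bound: "\<And>n. e n \<le> B"
    and step: "\<And>n. e (n + 2) \<le> \<delta> n + t * e n" and t: "0 \<le> t" "t < 1"
    and \<delta>: "\<delta> \<longlonglongrightarrow> 0"
  shows "e \<longlonglongrightarrow> 0"
proof (rule LIMSEQ_I)
  fix r :: real assume "0 < r"
  define \<epsilon> where "\<epsilon> = r / 2"
  have "0 < \<epsilon>"
    using \<open>0 < r\<close> by (simp add: \<epsilon>_def)
  then have "0 < \<epsilon> * (1 - t)"
    using t by simp
  then obtain N where N: "\<And>n. n \<ge> N \<Longrightarrow> \<delta> n \<le> \<epsilon> * (1 - t)"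
    using LIMSEQ_D[OF \<delta>, of "\<epsilon> * (1 - t)"] by (fastforce dest: less_imp_le)
  have iter: "e n \<le> \<epsilon> + t ^ m * B" if "n \<ge> N + 2 * m" for m n
    using that
  proof (induction m arbitrary: n)
    case 0
    then show ?case
      using bound[of n] \<open>0 < \<epsilon>\<close> by simp
  next
    case (Suc m)
    then obtain k where k: "n = k + 2" "k \<ge> N + 2 * m"
      using le_Suc_ex[of "2" n] by (auto simp: add.commute)
    have "e n \<le> \<epsilon> * (1 - t) + t * e k"
      using step[of k] N[of k] k by simp
    also have "t * e k \<le> t * (\<epsilon> + t ^ m * B)"
      using Suc.IH[OF k(2)] t(1) by (rule mult_left_mono)
    finally show ?case
      by (simp add: algebra_simps)
  qed
  have "(\<lambda>m. t ^ m * B) \<longlonglongrightarrow> 0 * B"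
    using t by (intro tendsto_intros LIMSEQ_realpow_zero)
  then obtain m where "t ^ m * B < \<epsilon>"
    using order_tendstoD(2)[of _ "0 * B" sequentially \<epsilon>] \<open>0 < \<epsilon>\<close>
    by (fastforce dest: eventually_happens)
  then have "e n < r" if "n \<ge> N + 2 * m" for n
    using iter[OF that] by (simp add: \<epsilon>_def)
  then show "\<exists>N. \<forall>n\<ge>N. norm (e n - 0) < r"
    using nonneg by (intro exI[of _ "N + 2 * m"]) auto
qed

text \<open>Subtracting the fixed point equation, the difference of squares contributes the factor
  \<open>s * (y n + x)\<close>, which is at most \<open>2 * s * M < 1\<close>.\<close>

lemma tendsto_fixpoint_quadratic_iteration:
  fixes y c :: "nat \<Rightarrow> real"
  assumes step: "\<And>n. y (n + 2) = c n + s * (y n)\<^sup>2" and c: "c \<longlonglongrightarrow> c0"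
    and fixpoint: "x = c0 + s * x\<^sup>2"
    and y: "\<And>n. 0 \<le> y n" "\<And>n. y n \<le> M" and x: "0 \<le> x" "x \<le> M"
    and s: "0 \<le> s" "2 * s * M < 1"
  shows "y \<longlonglongrightarrow> x"
proof -
  have "(\<lambda>n. \<bar>y n - x\<bar>) \<longlonglongrightarrow> 0"
  proof (rule tendsto_0_perturbed_contraction[where B = M and t = "2 * s * M" and \<delta> = "\<lambda>n. \<bar>c n - c0\<bar>"])
    fix n
    show "\<bar>y n - x\<bar> \<le> M"
      using y[of n] x by auto
    have "y (n + 2) - x = (c n - c0) + s * (y n + x) * (y n - x)"
      unfolding step using fixpoint by (simp add: algebra_simps power2_eq_square)
    then have "\<bar>y (n + 2) - x\<bar> \<le> \<bar>c n - c0\<bar> + s * (y n + x) * \<bar>y n - x\<bar>"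
      using abs_triangle_ineq[of "c n - c0" "s * (y n + x) * (y n - x)"] y[of n] x s
      by (simp add: abs_mult)
    also have "s * (y n + x) * \<bar>y n - x\<bar> \<le> s * (2 * M) * \<bar>y n - x\<bar>"
      using y[of n] x s by (intro mult_right_mono mult_left_mono) auto
    finally show "\<bar>y (n + 2) - x\<bar> \<le> \<bar>c n - c0\<bar> + 2 * s * M * \<bar>y n - x\<bar>"
      by (simp add: mult_ac)
    show "(\<lambda>n. \<bar>c n - c0\<bar>) \<longlonglongrightarrow> 0"
      using c LIM_zero tendsto_rabs_zero by blast
  qed (use x s in auto)
  then show ?thesis
    using tendsto_rabs_zero_iff LIM_zero_iff by blast
qed

section \<open>The roots of the quadratic polynomial\<close>

text \<open>The discriminant \<open>D\<close> decreases in \<open>h\<close>, and at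
  \<open>h = 1\<close> it is the square of \<open>1 - 2 * phi ^ 3\<close>, where the smaller root is
  exactly \<open>phi / 2\<close>. Positivity of that root is \<open>D < 1\<close>.\<close>

lemma root_poly_roots:
  assumes "0 < h" "h \<le> 1"
  shows "\<exists>x'. smaller_root h < x' \<and> {x. poly (root_poly h) x = 0} = {smaller_root h, x'}"
    and "0 < smaller_root h" and "smaller_root h \<le> phi / 2"
proof -
  define D where "D = 1 - 8 * phi ^ 5 * h"
  have p5: "phi ^ 5 = phi\<^sup>2 * phi ^ 3"
    by (simp flip: power_add)
  have "phi ^ 5 * h \<le> phi ^ 5 * 1"
    using assms phi_pos by (intro mult_left_mono) auto
  moreover have "(1 - 2 * phi ^ 3)\<^sup>2 = 1 - 8 * phi ^ 5"
    unfolding p5 phi_sq phi_cube using phi_sq by (simp add: power2_eq_square algebra_simps)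
  ultimately have D: "(1 - 2 * phi ^ 3)\<^sup>2 \<le> D"
    by (simp add: D_def)
  have "2 * phi ^ 3 < 1"
    using phi_cube_le phi_less_1 by linarith
  then have "0 < (1 - 2 * phi ^ 3)\<^sup>2"
    by simp
  then have "0 < D"
    using D by linarith
  have sqrt_D: "1 - 2 * phi ^ 3 \<le> sqrt D"
    using D by (rule real_le_rsqrt)
  have "D < 1"
    using assms phi_pos by (simp add: D_def)
  then have "sqrt D < 1"
    by simp
  let ?x = "(1 - sqrt D) / (4 * phi\<^sup>2)" and ?x' = "(1 + sqrt D) / (4 * phi\<^sup>2)"
  \<comment> \<open>Vieta: the candidates have product \<open>phi * h / 2\<close> and sum
    \<open>1 / (2 * phi ^ 2)\<close>.\<close>
  have factor: "poly (root_poly h) x = 2 * phi\<^sup>2 * ((x - ?x) * (x - ?x'))" for x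
  proof -
    have "sqrt D * sqrt D = D"
      using \<open>0 < D\<close> by simp
    then have "(1 - sqrt D) * (1 + sqrt D) = 8 * phi ^ 5 * h"
      by (simp add: D_def algebra_simps)
    then have "?x * ?x' = 8 * phi ^ 5 * h / (4 * phi\<^sup>2 * (4 * phi\<^sup>2))"
      by (simp only: times_divide_times_eq)
    also have "\<dots> = phi * h / 2"
      using phi_pos by (simp add: field_simps eval_nat_numeral)
    finally have "?x * ?x' = phi * h / 2" .
    moreover have "?x + ?x' = 1 / (2 * phi\<^sup>2)"
      by (simp add: add_divide_distrib diff_divide_distrib)
    moreover have "(x - ?x) * (x - ?x') = x * x - (?x + ?x') * x + ?x * ?x'"
      by (simp only: algebra_simps)
    ultimately have eq: "(x - ?x) * (x - ?x') = x * x - 1 / (2 * phi\<^sup>2) * x + phi * h / 2"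
      by metis
    show ?thesis
      unfolding eq using phi_pos by (simp add: root_poly_def field_simps eval_nat_numeral)
  qed
  have roots: "{x. poly (root_poly h) x = 0} = {?x, ?x'}"
    unfolding factor using phi_pos by auto
  have less: "?x < ?x'"
    using \<open>0 < D\<close> phi_pos by (simp add: divide_strict_right_mono)
  have small: "smaller_root h = ?x"
    unfolding smaller_root_def roots using less by (simp add: min_def)
  show "\<exists>x'. smaller_root h < x' \<and> {x. poly (root_poly h) x = 0} = {smaller_root h, x'}"
    unfolding small using roots less by blast
  show "0 < smaller_root h"
    unfolding small using \<open>sqrt D < 1\<close> phi_pos by simp
  have "?x \<le> (2 * phi ^ 3) / (4 * phi\<^sup>2)"
    using sqrt_D by (intro divide_right_mono) auto
  also have "\<dots> = phi / 2"
    using phi_pos by (simp add: field_simps eval_nat_numeral)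
  finally show "smaller_root h \<le> phi / 2"
    unfolding small .
qed

lemma smaller_root_fixpoint:
  assumes "0 < h" "h \<le> 1"
  shows "smaller_root h = phi ^ 3 * h + 2 * phi\<^sup>2 * (smaller_root h)\<^sup>2"
proof -
  have "poly (root_poly h) (smaller_root h) = 0"
    using root_poly_roots(1)[OF assms] by blast
  then show ?thesis
    by (simp add: root_poly_def algebra_simps power2_eq_square)
qed

section \<open>The coefficient \<open>H(d)\<close> as a telescoping expression\<close>

lemma sum_convolution_diff:
  fixes A :: "nat \<Rightarrow> real"
  assumes "A 0 = 0"
  shows "(\<Sum>(r, s)\<in>{(r, s). 1 \<le> r \<and> 1 \<le> s \<and> r + s = d}. A r * A s)
      - (\<Sum>(r, s)\<in>{(r, s). 1 \<le> r \<and> 1 \<le> s \<and> r + s = d - 1}. A r * A s)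
    = (\<Sum>r\<in>{1..<d}. (A r - A (r - 1)) * A (d - r))"
proof -
  have conv: "(\<Sum>(r, s)\<in>{(r, s). 1 \<le> r \<and> 1 \<le> s \<and> r + s = k}. A r * A s)
      = (\<Sum>r\<in>{1..<k}. A r * A (k - r))" for k
    by (rule sum.reindex_bij_witness[of _ "\<lambda>r. (r, k - r)" fst]) auto
  \<comment> \<open>Since \<open>A 0 = 0\<close>, a term \<open>r = 0\<close> may be added; after a
    shift by one both sums have the same range and the common factor
    \<open>A (d - r)\<close>.\<close>
  have "(\<Sum>r\<in>{1..<d - 1}. A r * A (d - 1 - r)) = (\<Sum>r\<in>{0..<d - 1}. A r * A (d - 1 - r))"
    using assms by (intro sum.mono_neutral_left) (auto simp: not_le less_Suc0)
  also have "\<dots> = (\<Sum>r\<in>{1..<d}. A (r - 1) * A (d - r))"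
    by (rule sum.reindex_bij_witness[of _ "\<lambda>r. r - 1" Suc]) auto
  finally show ?thesis
    unfolding conv by (simp add: sum_subtractf left_diff_distrib)
qed

text \<open>Continues \<^const>\<open>xi\<close> to index \<open>0\<close> by the limit of the normalised tail there.\<close>

definition xi0 :: "nat \<Rightarrow> real" where
  "xi0 d = (if d = 0 then 1 else xi d)"

text \<open>The \<open>h\<close> of the overview. If \<open>(x r)\<^sup>2\<close> is the tail at
  \<open>r\<close> of each of two independent positive costs, this is the probability that their sum
  exceeds \<open>d\<close>. It is applied both to \<open>win_tail n\<close> and to the limit
  \<open>xi0\<close>.\<close>

definition step_coeff :: "(nat \<Rightarrow> real) \<Rightarrow> nat \<Rightarrow> real" where
  "step_coeff x d = 1 - (\<Sum>r\<in>{1..<d}. ((x (r - 1))\<^sup>2 - (x r)\<^sup>2) * (1 - (x (d - r))\<^sup>2))"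

text \<open>The value \<open>xi0 0 = 1\<close> supplies \<open>A 0 = 0\<close> for the shift of the
  convolution, while the sums in \<open>H\<close> only see indices from 1 on, where
  \<open>xi0\<close> is \<open>xi\<close>.\<close>

lemma fragility_H_eq:
  assumes "d \<ge> 1"
  shows "fragility_H d = step_coeff xi0 d"
proof (cases "d = 1")
  case True
  then show ?thesis
    by (simp add: fragility_H.simps step_coeff_def)
next
  case False
  let ?A = "\<lambda>r. 1 - (xi0 r)\<^sup>2"
  let ?S = "\<lambda>k f. \<Sum>(r, s)\<in>{(r, s). 1 \<le> r \<and> 1 \<le> s \<and> r + s = k}. (1 - (f r)\<^sup>2) * (1 - (f s)\<^sup>2)"
  have "?S k xi = ?S k xi0" for k
    by (intro sum.cong refl) (auto simp: xi0_def)
  then have "fragility_H d = 1 - (?S d xi0 - ?S (d - 1) xi0)"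
    using False assms by (subst fragility_H.simps) (simp add: xi_def[symmetric])
  also have "\<dots> = step_coeff xi0 d"
    by (subst sum_convolution_diff[of ?A]) (auto simp: xi0_def step_coeff_def)
  finally show ?thesis .
qed

text \<open>All summands are nonnegative; replacing their second factors by 1 leaves a telescoping
  sum. For \<open>xi0\<close> the bounds place \<open>H(d)\<close> in the range required by
  \<open>root_poly_roots\<close>.\<close>

lemma step_coeff_bounds:
  assumes "x 0 = 1" "\<And>r s. r \<le> s \<Longrightarrow> s < d \<Longrightarrow> x s \<le> x r" "\<And>r. r < d \<Longrightarrow> 0 \<le> x r" "1 \<le> d"
  shows "step_coeff x d \<le> 1" and "(x (d - 1))\<^sup>2 \<le> step_coeff x d"
proof -
  let ?S = "\<Sum>r\<in>{1..<d}. ((x (r - 1))\<^sup>2 - (x r)\<^sup>2) * (1 - (x (d - r))\<^sup>2)"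
  have diff: "0 \<le> (x (r - 1))\<^sup>2 - (x r)\<^sup>2" if "r < d" for r
    using that assms by (simp add: power_mono)
  have le_1: "(x r)\<^sup>2 \<le> 1" if "r < d" for r
    using power_mono[of "x r" 1 2] assms(2)[of 0 r] assms(1,3) that by simp
  have "0 \<le> ?S"
    using diff le_1 by (intro sum_nonneg mult_nonneg_nonneg) auto
  then show "step_coeff x d \<le> 1"
    by (simp add: step_coeff_def)
  have "?S \<le> (\<Sum>r\<in>{1..<d}. ((x (r - 1))\<^sup>2 - (x r)\<^sup>2) * 1)"
    using diff by (intro sum_mono mult_left_mono) auto
  also have "\<dots> = (\<Sum>r<d - 1. (x r)\<^sup>2 - (x (Suc r))\<^sup>2)"
    by (rule sum.reindex_bij_witness[of _ Suc "\<lambda>r. r - 1"]) auto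
  also have "\<dots> = 1 - (x (d - 1))\<^sup>2"
    by (simp add: sum_lessThan_telescope'[of "\<lambda>r. (x r)\<^sup>2"] assms(1))
  finally show "(x (d - 1))\<^sup>2 \<le> step_coeff x d"
    by (simp add: step_coeff_def)
qed

text \<open>The player to move at the root of a game of depth \<open>n\<close> is Player 1 iff \<open>n\<close> is even. That player
  wins with probability \<^const>\<open>phi\<close>, so the following is the conditional probability that the distance exceeds
  \<open>d\<close>, given this win.\<close>

definition win_tail :: "nat \<Rightarrow> nat \<Rightarrow> real" where
  "win_tail n d = tail n (odd n) d / phi"

section \<open>The recursion of the normalised tail over two levels\<close>

lemma tail_eq_win_tail: "tail n (odd n) d = phi * win_tail n d"
  using phi_pos by (simp add: win_tail_def)

lemma lose_tail: "tail (Suc n) (odd n) d = phi\<^sup>2 * (win_tail n d)\<^sup>2"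
  by (simp add: tail_min tail_eq_win_tail power_mult_distrib)

text \<open>A child is won by the root's mover with probability \<open>phi\<^sup>2\<close>. Given
  that the mover wins, both children are won with probability \<open>phi ^ 3\<close>, and their
  costs add; exactly one is won with probability \<open>2 * phi\<^sup>2\<close>, and only its cost,
  a minimum of two, counts.\<close>

lemma win_tail_step:
  assumes "win_tail n 0 = 1" "1 \<le> d"
  shows "win_tail (n + 2) d = phi ^ 3 * step_coeff (win_tail n) d + 2 * phi\<^sup>2 * (win_tail n d)\<^sup>2"
proof -
  let ?y = "win_tail n"
  let ?D = "\<lambda>r. (?y (r - 1))\<^sup>2 - (?y r)\<^sup>2"
  let ?S = "\<Sum>r\<in>{1..<d}. ?D r * (1 - (?y (d - r))\<^sup>2)"
  have telescope: "(\<Sum>r\<in>{1..d}. ?D r) = 1 - (?y d)\<^sup>2"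
  proof -
    have "(\<Sum>r\<in>{1..d}. ?D r) = (\<Sum>r<d. (?y r)\<^sup>2 - (?y (Suc r))\<^sup>2)"
      by (rule sum.reindex_bij_witness[of _ Suc "\<lambda>r. r - 1"]) auto
    then show ?thesis
      by (simp add: sum_lessThan_telescope'[of "\<lambda>r. (?y r)\<^sup>2"] assms(1))
  qed
  \<comment> \<open>The added term \<open>r = d\<close> vanishes because
    \<open>win_tail n 0 = 1\<close>.\<close>
  have S: "?S = (\<Sum>r\<in>{1..d}. ?D r * (1 - (?y (d - r))\<^sup>2))"
    using assms by (intro sum.mono_neutral_left) auto
  have phi_eq: "1 - phi\<^sup>2 = phi"
    by (simp add: phi_sq)
  \<comment> \<open>Splits the event of cost at most \<open>k\<close> at a child: cost zero has
    probability \<open>phi\<close>, positive cost up to \<open>k\<close> the rest.\<close>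
  then have A: "1 - phi\<^sup>2 * z = phi + phi\<^sup>2 * (1 - z)" for z
    by (simp add: algebra_simps)
  have "phi * win_tail (n + 2) d = tail (Suc (Suc n)) (odd n) d"
    by (simp add: win_tail_def phi_pos[THEN less_imp_neq, symmetric])
  also have "\<dots> = 1 - phi * (phi + phi\<^sup>2 * (1 - (?y d)\<^sup>2))
      - (\<Sum>r\<in>{1..d}. phi\<^sup>2 * ?D r * (phi + phi\<^sup>2 * (1 - (?y (d - r))\<^sup>2)))"
    by (subst tail_sum) (simp_all add: lose_tail assms(1) A phi_eq right_diff_distrib)
  also have "(\<Sum>r\<in>{1..d}. phi\<^sup>2 * ?D r * (phi + phi\<^sup>2 * (1 - (?y (d - r))\<^sup>2)))
      = phi ^ 3 * (\<Sum>r\<in>{1..d}. ?D r) + phi ^ 4 * (\<Sum>r\<in>{1..d}. ?D r * (1 - (?y (d - r))\<^sup>2))"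
    unfolding sum_distrib_left sum.distrib[symmetric]
    by (intro sum.cong refl) (simp add: eval_nat_numeral algebra_simps)
  also have "\<dots> = phi ^ 3 * (1 - (?y d)\<^sup>2) + phi ^ 4 * ?S"
    unfolding telescope S ..
  also have "1 - phi * (phi + phi\<^sup>2 * (1 - (?y d)\<^sup>2)) - (phi ^ 3 * (1 - (?y d)\<^sup>2) + phi ^ 4 * ?S)
      = (1 - phi\<^sup>2) - 2 * phi ^ 3 * (1 - (?y d)\<^sup>2) - phi ^ 4 * ?S"
    by (simp add: eval_nat_numeral algebra_simps)
  \<comment> \<open>The weights of the two cases sum to one:
    \<open>phi ^ 3 + 2 * phi\<^sup>2 = 1\<close>.\<close>
  also have "1 - phi\<^sup>2 = phi * (phi ^ 3 + 2 * phi\<^sup>2)"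
    by (simp add: phi_sq phi_cube)
  also have "phi * (phi ^ 3 + 2 * phi\<^sup>2) - 2 * phi ^ 3 * (1 - (?y d)\<^sup>2) - phi ^ 4 * ?S
      = phi * (phi ^ 3 * (1 - ?S) + 2 * phi\<^sup>2 * (?y d)\<^sup>2)"
    by (simp add: eval_nat_numeral algebra_simps)
  finally show ?thesis
    using phi_pos by (simp add: step_coeff_def)
qed

text \<open>The mover wins with probability \<open>phi\<close> at every depth: some child's mover
  must lose, and \<open>1 - (1 - phi\<^sup>2)\<^sup>2 = phi\<close>.\<close>

lemma win_tail_0: "win_tail n 0 = 1"
proof (induction n rule: induct_nat_012)
  case 0
  then show ?case
    using phi_pos by (simp add: win_tail_def tail_0)
next
  case 1
  show ?case
    using phi_pos phi_sq by (simp add: win_tail_def tail_sum tail_0 power2_eq_square)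
next
  case (ge2 n)
  have "tail (Suc (Suc n)) (odd n) 0 = 1 - (1 - phi\<^sup>2) * (1 - phi\<^sup>2)"
    by (subst tail_sum) (simp_all add: lose_tail ge2)
  also have "\<dots> = phi"
    using phi_sq by (simp add: power2_eq_square)
  finally show ?case
    using phi_pos by (simp add: win_tail_def)
qed

lemma win_tail_nonneg: "0 \<le> win_tail n d"
  using phi_pos by (simp add: win_tail_def tail_nonneg)

lemma antimono_win_tail: "d \<le> e \<Longrightarrow> win_tail n e \<le> win_tail n d"
  using phi_pos by (simp add: win_tail_def antimono_tail divide_right_mono)

text \<open>The bound is the fixed point of the two-level map at its largest coefficient 1, so it is
  preserved; depths 0 and 1 start the two parities.\<close>

lemma win_tail_le:
  assumes "1 \<le> d"
  shows "win_tail n d \<le> phi / 2"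
proof (induction n rule: induct_nat_012)
  case 0
  then show ?case
    using assms phi_pos by (simp add: win_tail_def tail_0)
next
  case 1
  have "tail (Suc 0) True 1 = 1 - phi - (1 - phi) * phi"
    by (subst tail_sum) (simp_all add: tail_0)
  also have "\<dots> = phi ^ 3 * phi"
    unfolding phi_cube using phi_sq by (simp add: power2_eq_square algebra_simps)
  finally have "win_tail 1 1 = phi ^ 3"
    using phi_pos by (simp add: win_tail_def)
  then show ?case
    using antimono_win_tail[OF assms, of 1] phi_cube_le by simp
next
  case (ge2 n)
  have "win_tail (n + 2) d = phi ^ 3 * step_coeff (win_tail n) d + 2 * phi\<^sup>2 * (win_tail n d)\<^sup>2"
    using win_tail_step[OF win_tail_0 assms] .
  also have "\<dots> \<le> phi ^ 3 * 1 + 2 * phi\<^sup>2 * (phi / 2)\<^sup>2"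
    using step_coeff_bounds(1)[of "win_tail n" d] win_tail_0 antimono_win_tail win_tail_nonneg
      assms phi_pos ge2(1)
    by (intro add_mono mult_left_mono power_mono) auto
  also have "\<dots> = phi / 2"
  proof -
    have "2 * phi\<^sup>2 * (phi / 2)\<^sup>2 = phi * phi ^ 3 / 2"
      by (simp add: eval_nat_numeral)
    then show ?thesis
      using phi_sq by (simp add: phi_cube power2_eq_square algebra_simps)
  qed
  finally show ?case
    by simp
qed

text \<open>One joint induction: limits at smaller indices bound \<open>H(d)\<close>, and these
  bounds make \<open>xi d\<close> a fixed point in the region of contraction.\<close>

lemma fragility_H_bounds_and_win_tail_tendsto:
  assumes "d \<ge> 1"
  shows "0 < fragility_H d \<and> fragility_H d \<le> 1 \<and> (\<lambda>n. win_tail n d) \<longlonglongrightarrow> xi d"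
  using assms
proof (induction d rule: less_induct)
  case (less d)
  have lim: "(\<lambda>n. win_tail n r) \<longlonglongrightarrow> xi0 r" if "r < d" for r
    using less.IH[of r] that by (cases "r = 0") (auto simp: xi0_def win_tail_0)
  \<comment> \<open>Monotonicity of \<open>xi0\<close> is inherited from the tails in the limit, not
    read off the recursion.\<close>
  have antimono: "xi0 s \<le> xi0 r" if "r \<le> s" "s < d" for r s
    using that by (intro LIMSEQ_le[OF lim lim]) (auto simp: antimono_win_tail)
  have pos: "0 < xi0 r" if "r < d" for r
    using less.IH[of r] that by (auto simp: xi0_def xi_def root_poly_roots(2))
  have H: "fragility_H d = step_coeff xi0 d"
    using less.prems by (rule fragility_H_eq)
  have "0 < (xi0 (d - 1))\<^sup>2"
    using pos[of "d - 1"] less.prems by simp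
  also have "\<dots> \<le> fragility_H d"
    unfolding H using antimono pos less.prems
    by (intro step_coeff_bounds) (auto simp: xi0_def less_imp_le)
  finally have H_pos: "0 < fragility_H d" .
  have H_le: "fragility_H d \<le> 1"
    unfolding H using antimono pos less.prems
    by (intro step_coeff_bounds) (auto simp: xi0_def less_imp_le)
  have "(\<lambda>n. win_tail n d) \<longlonglongrightarrow> xi d"
  proof (rule tendsto_fixpoint_quadratic_iteration[where M = "phi / 2"])
    show "win_tail (n + 2) d = phi ^ 3 * step_coeff (win_tail n) d + 2 * phi\<^sup>2 * (win_tail n d)\<^sup>2" for n
      using win_tail_step[OF win_tail_0 less.prems] .
    show "(\<lambda>n. phi ^ 3 * step_coeff (win_tail n) d) \<longlonglongrightarrow> phi ^ 3 * fragility_H d"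
      unfolding H step_coeff_def by (intro tendsto_intros lim) auto
    show "xi d = phi ^ 3 * fragility_H d + 2 * phi\<^sup>2 * (xi d)\<^sup>2"
      unfolding xi_def by (rule smaller_root_fixpoint[OF H_pos H_le])
    have "2 * (2 * phi\<^sup>2) * (phi / 2) = 2 * phi ^ 3"
      by (simp add: eval_nat_numeral)
    then show "2 * (2 * phi\<^sup>2) * (phi / 2) < 1"
      using phi_cube_le phi_less_1 by linarith
  qed (use less.prems win_tail_nonneg win_tail_le root_poly_roots[OF H_pos H_le]
      in \<open>auto simp: xi_def less_imp_le\<close>)
  then show ?case
    using H_pos H_le by simp
qed

theorem theorem5:
  fixes d :: nat
  assumes "d \<ge> 1"
  shows "(\<exists>x'. xi d < x' \<and> {x. poly (root_poly (fragility_H d)) x = 0} = {xi d, x'})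
    \<and> 0 < xi d \<and> xi d < 1
    \<and> (\<lambda>n. fragile_prob n d) \<longlonglongrightarrow> 1 - phi * xi d - phi\<^sup>2 * (xi d)\<^sup>2"
proof -
  have H: "0 < fragility_H d" "fragility_H d \<le> 1" and lim: "(\<lambda>n. win_tail n d) \<longlonglongrightarrow> xi d"
    using fragility_H_bounds_and_win_tail_tendsto[OF assms] by auto
  \<comment> \<open>The depth is shifted because the losing tail at \<open>Suc n\<close> is
    expressed by the winning tail at \<open>n\<close>.\<close>
  have "fragile_prob (Suc n) d = 1 - phi * win_tail (Suc n) d - phi\<^sup>2 * (win_tail n d)\<^sup>2" for n
    using tail_eq_win_tail[of "Suc n" d] by (simp add: fragile_prob_eq lose_tail)
  moreover have "(\<lambda>n. 1 - phi * win_tail (Suc n) d - phi\<^sup>2 * (win_tail n d)\<^sup>2)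
      \<longlonglongrightarrow> 1 - phi * xi d - phi\<^sup>2 * (xi d)\<^sup>2"
    by (intro tendsto_intros lim LIMSEQ_Suc)
  ultimately have "(\<lambda>n. fragile_prob (Suc n) d) \<longlonglongrightarrow> 1 - phi * xi d - phi\<^sup>2 * (xi d)\<^sup>2"
    by simp
  then have "(\<lambda>n. fragile_prob n d) \<longlonglongrightarrow> 1 - phi * xi d - phi\<^sup>2 * (xi d)\<^sup>2"
    by (rule LIMSEQ_imp_Suc)
  moreover have "xi d < 1"
    using root_poly_roots(3)[OF H] phi_less_1 by (simp add: xi_def)
  ultimately show ?thesis
    using root_poly_roots(1,2)[OF H] by (simp add: xi_def)
qed

end
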